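(* There exists a lattice game on the board $\mathbb{N}^3$ with normal play (that is, with no defeated positions, $\mathcal D=\emptyset$) which has no rational strategy: its set $\mathcal P$ of $\mathrm{P}$-positions does not have a rational generating function $\sum_{p\in\mathcal P}x^p\in\mathbb{Z}[[x_1,x_2,x_3]]$.
   Context: A lattice game on $\mathbb{N}^3$ is specified by (1) a finite set $\mathcal D\subseteq\mathbb{N}^3$ of defeated positions such that the board $\mathcal B:=\mathbb{N}^3\setminus\mathcal D$ satisfies $\mathcal B+\mathbb{N}^3\subseteq\mathcal B$; and (2) a ruleset $\Gamma\subseteq\mathbb{Z}^3$, a finite set satisfying: (i) (pointedness) there is a linear functional $\varphi:\mathbb{R}^3\to\mathbb{R}$ with $\varphi(\gamma)>0$ for all $\gamma\in\Gamma$ and $\varphi(e_i)>0$ for $i=1,2,3$; (ii) (tangent cone axiom) for each ray $\rho=\mathbb{R}_{\ge0}e_i$ of $\mathbb{R}^3_{\ge0}$ there is $\gamma\in\Gamma$ with $-\gamma\in\mathbb{R}^3_{\ge0}+\mathbb{R}e_i$ (i.e. $\gamma_j\le0$ for all $j\ne i$). The positions are the elements of $\mathcal B$; the options of $p\in\mathcal B$ are the points $p-\gamma$ with $\gamma\in\Gamma$ and $p-\gamma\in\mathcal B$. Outcomes are defined by induction on $\varphi$: $p$ is a $\mathrm{P}$-position if none of its options is a $\mathrm{P}$-position, and an $\mathrm{N}$-position otherwise. Normal play means $\mathcal D=\emptyset$. The game has a rational strategy if the generating function $\sum_{p\in\mathcal P}x^p$ of its set $\mathcal P$ of $\mathrm{P}$-positions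 is a rational function of $x_1,x_2,x_3$ (equivalently, $\mathcal P$ is a finite disjoint union of intersections of rational polyhedra with translates of sublattices of $\mathbb{Z}^3$). *)

theory Defs
  imports Complex_Main
begin

text \<open>Points of the board N^3 are triples of naturals; rules are triples of integers.
  Normal play: the board is all of N^3 (no defeated positions).\<close>

type_synonym pos = "nat \<times> nat \<times> nat"
type_synonym rule = "int \<times> int \<times> int"

definition is_option :: "rule set \<Rightarrow> pos \<Rightarrow> pos \<Rightarrow> bool" where
  "is_option \<Gamma> p q \<longleftrightarrow> (\<exists>(g1, g2, g3) \<in> \<Gamma>.
      int (fst q) = int (fst p) - g1 \<and>
      int (fst (snd q)) = int (fst (snd p)) - g2 \<and>
      int (snd (snd q)) = int (snd (snd p)) - g3)"

definition option_rel :: "rule set \<Rightarrow> (pos \<times> pos) set" where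
  "option_rel \<Gamma> = {(q, p). is_option \<Gamma> p q}"

definition pointed :: "rule set \<Rightarrow> bool" where
  "pointed \<Gamma> \<longleftrightarrow> (\<exists>c1 c2 c3 :: real. c1 > 0 \<and> c2 > 0 \<and> c3 > 0 \<and>
      (\<forall>(g1, g2, g3) \<in> \<Gamma>. c1 * of_int g1 + c2 * of_int g2 + c3 * of_int g3 > 0))"

definition tangent_cone_axiom :: "rule set \<Rightarrow> bool" where
  "tangent_cone_axiom \<Gamma> \<longleftrightarrow>
     (\<exists>(g1, g2, g3) \<in> \<Gamma>. g2 \<le> 0 \<and> g3 \<le> 0) \<and>
     (\<exists>(g1, g2, g3) \<in> \<Gamma>. g1 \<le> 0 \<and> g3 \<le> 0) \<and>
     (\<exists>(g1, g2, g3) \<in> \<Gamma>. g1 \<le> 0 \<and> g2 \<le> 0)"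

definition ruleset :: "rule set \<Rightarrow> bool" where
  "ruleset \<Gamma> \<longleftrightarrow> finite \<Gamma> \<and> pointed \<Gamma> \<and> tangent_cone_axiom \<Gamma>"

text \<open>P-positions, defined by well-founded recursion along the option relation
  (well-founded under pointedness): p is a P-position iff no option of p is a P-position.\<close>
definition is_P :: "rule set \<Rightarrow> pos \<Rightarrow> bool" where
  "is_P \<Gamma> = wfrec (option_rel \<Gamma>) (\<lambda>f p. \<not> (\<exists>q. is_option \<Gamma> p q \<and> f q))"

definition P_positions :: "rule set \<Rightarrow> pos set" where
  "P_positions \<Gamma> = {p. is_P \<Gamma> p}"

definition ps_mult :: "(pos \<Rightarrow> int) \<Rightarrow> (pos \<Rightarrow> int) \<Rightarrow> pos \<Rightarrow> int" where
  "ps_mult A B n = (case n of (n1, n2, n3) \<Rightarrow>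
     (\<Sum>(m1, m2, m3) \<in> {0..n1} \<times> {0..n2} \<times> {0..n3}.
        A (m1, m2, m3) * B (n1 - m1, n2 - m2, n3 - m3)))"

text \<open>A power series F in Z[[x1,x2,x3]] is a rational function iff Q*F is a polynomial
  for some nonzero polynomial Q (here with integer coefficients; equivalent to any field
  of characteristic 0 by clearing denominators / linear algebra).\<close>
definition rational_ps :: "(pos \<Rightarrow> int) \<Rightarrow> bool" where
  "rational_ps F \<longleftrightarrow> (\<exists>Q :: pos \<Rightarrow> int. finite {m. Q m \<noteq> 0} \<and> (\<exists>m. Q m \<noteq> 0) \<and>
      finite {n. ps_mult Q F n \<noteq> 0})"

definition gen_fun :: "pos set \<Rightarrow> pos \<Rightarrow> int" where
  "gen_fun S p = (if p \<in> S then 1 else 0)"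

end

theory Submission
  imports Defs
begin

text \<open>All rules but \<open>(0, 0, 1)\<close> keep the third coordinate, so on the plane \<open>z = 0\<close> the game is
  a two-dimensional game.  Its P-positions can be listed in closed form: the rows \<open>y = 2 m\<close> and
  \<open>y = 2 m + 1\<close> split at a parabola \<open>x \<approx> y\<^sup>2\<close>; to the left of it the pattern consists of cells of width 8
  grouped into blocks of 1, 2, 3, \<open>\<dots>\<close> cells, to the right of it of blocks of lengths \<open>8 j + 6\<close> that move to the left by 6
  from one pair of rows to the next.  On the axis \<open>y = z = 0\<close> this leaves a sequence of period 2
  disturbed exactly at the block boundaries, whose distances grow without bound.  The coefficients
  of a rational series along the axis satisfy a linear recurrence; applied to the difference of the
  sequence and its shift by 2 just at the end of a long undisturbed stretch it fails.\<close>

section \<open>Rational series along an axis\<close>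

text \<open>Take the exponent \<open>(a, b, c)\<close> in the support of \<open>Q\<close> that is
  least by \<open>c\<close>, then \<open>b\<close>, then \<open>a\<close>. In the product
  coefficient at \<open>(a + x, b, c)\<close> only the terms \<open>Q (a + i, b, c)\<close> survive,
  each paired with an axis coefficient of \<open>F\<close>.\<close>

lemma rational_ps_axis_recurrence:
  assumes "rational_ps F"
  obtains q :: "nat \<Rightarrow> int" and d where "q 0 \<noteq> 0"
    "\<And>x. d \<le> x \<Longrightarrow> (\<Sum>i\<le>d. q i * F (x - i, 0, 0)) = 0"
proof -
  obtain Q where Q: "finite {m. Q m \<noteq> 0}" "\<exists>m. Q m \<noteq> 0" "finite {n. ps_mult Q F n \<noteq> 0}"
    using assms unfolding rational_ps_def by blast
  define c where "c = (LEAST c. \<exists>a b. Q (a, b, c) \<noteq> 0)"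
  have c: "\<exists>a b. Q (a, b, c) \<noteq> 0" unfolding c_def by (rule LeastI_ex) (use Q(2) in auto)
  have c_min: "c \<le> c'" if "Q (a, b, c') \<noteq> 0" for a b c'
    unfolding c_def by (rule Least_le) (use that in blast)
  define b where "b = (LEAST b. \<exists>a. Q (a, b, c) \<noteq> 0)"
  have b: "\<exists>a. Q (a, b, c) \<noteq> 0" unfolding b_def by (rule LeastI_ex) (use c in blast)
  have b_min: "b \<le> b'" if "Q (a, b', c) \<noteq> 0" for a b'
    unfolding b_def by (rule Least_le) (use that in blast)
  define a where "a = (LEAST a. Q (a, b, c) \<noteq> 0)"
  have a: "Q (a, b, c) \<noteq> 0" unfolding a_def by (rule LeastI_ex) (use b in blast)
  have a_min: "a \<le> a'" if "Q (a', b, c) \<noteq> 0" for a'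
    unfolding a_def by (rule Least_le) (use that in blast)
  define q where "q i = Q (a + i, b, c)" for i
  have conv: "ps_mult Q F (a + x, b, c) = (\<Sum>i\<le>x. q i * F (x - i, 0, 0))" for x
  proof -
    let ?B = "{0..a + x} \<times> {0..b} \<times> {0..c}"
    let ?g = "\<lambda>(m1, m2, m3). Q (m1, m2, m3) * F (a + x - m1, b - m2, c - m3)"
    have "ps_mult Q F (a + x, b, c) = sum ?g ?B" by (simp add: ps_mult_def)
    also have "\<dots> = sum ?g ((\<lambda>i. (a + i, b, c)) ` {..x})"
    proof (rule sum.mono_neutral_right)
      show "\<forall>m\<in>?B - (\<lambda>i. (a + i, b, c)) ` {..x}. ?g m = 0"
      proof clarify
        fix m1 m2 m3
        assume m: "m1 \<in> {0..a + x}" "m2 \<in> {0..b}" "m3 \<in> {0..c}" "(m1, m2, m3) \<notin> (\<lambda>i. (a + i, b, c)) ` {..x}"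
        have "Q (m1, m2, m3) = 0"
        proof (rule ccontr)
          assume "Q (m1, m2, m3) \<noteq> 0"
          then have "m3 = c" "m2 = b" "a \<le> m1"
            using c_min[of m1 m2 m3] b_min[of m1 m2] a_min[of m1] m by force+
          then have "(m1, m2, m3) = (a + (m1 - a), b, c)" "m1 - a \<in> {..x}" using m by auto
          then show False using m(4) by blast
        qed
        then show "Q (m1, m2, m3) * F (a + x - m1, b - m2, c - m3) = 0" by simp
      qed
    qed auto
    also have "\<dots> = (\<Sum>i\<le>x. q i * F (x - i, 0, 0))"
      by (subst sum.reindex) (auto simp: inj_on_def q_def)
    finally show ?thesis .
  qed
  \<comment> \<open>One bound for both supports: it limits the order of the recurrence and marks
    where the product vanishes.\<close>
  define M where "M = Max (insert 0 (fst ` ({m. Q m \<noteq> 0} \<union> {n. ps_mult Q F n \<noteq> 0})))"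
  define d where "d = Suc M"
  have M: "fst n \<le> M" if "Q n \<noteq> 0 \<or> ps_mult Q F n \<noteq> 0" for n
    unfolding M_def by (rule Max_ge) (use Q that in auto)
  show thesis
  proof (rule that[of q d])
    show "q 0 \<noteq> 0" using a by (simp add: q_def)
    fix x assume "d \<le> x"
    have "q i = 0" if "d < i" for i
      using M[of "(a + i, b, c)"] that by (auto simp: q_def d_def)
    then have "(\<Sum>i\<le>d. q i * F (x - i, 0, 0)) = (\<Sum>i\<le>x. q i * F (x - i, 0, 0))"
      using \<open>d \<le> x\<close> by (intro sum.mono_neutral_left) auto
    also have "\<dots> = 0"
      using conv[of x] M[of "(a + x, b, c)"] \<open>d \<le> x\<close> by (auto simp: d_def)
    finally show "(\<Sum>i\<le>d. q i * F (x - i, 0, 0)) = 0" .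
  qed
qed

text \<open>Subtracting the recurrence at \<open>x - p\<close> from that at \<open>x\<close> leaves
  only the term \<open>i = 0\<close>, whose coefficient \<open>q 0\<close> is nonzero.\<close>

lemma not_rational_ps_axis:
  assumes "\<And>d. \<exists>x. d + p \<le> x \<and> F (x, 0, 0) \<noteq> F (x - p, 0, 0) \<and>
             (\<forall>i\<in>{1..d}. F (x - i, 0, 0) = F (x - i - p, 0, 0))"
  shows "\<not> rational_ps F"
proof
  assume "rational_ps F"
  then obtain q :: "nat \<Rightarrow> int" and d where q: "q 0 \<noteq> 0"
    "\<And>x. d \<le> x \<Longrightarrow> (\<Sum>i\<le>d. q i * F (x - i, 0, 0)) = 0"
    using rational_ps_axis_recurrence by metis
  obtain x where x: "d + p \<le> x" "F (x, 0, 0) \<noteq> F (x - p, 0, 0)"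
    "\<forall>i\<in>{1..d}. F (x - i, 0, 0) = F (x - i - p, 0, 0)" using assms by blast
  have "0 = (\<Sum>i\<le>d. q i * F (x - i, 0, 0)) - (\<Sum>i\<le>d. q i * F (x - p - i, 0, 0))"
    using q(2)[of x] q(2)[of "x - p"] x(1) by simp
  also have "\<dots> = (\<Sum>i\<le>d. q i * (F (x - i, 0, 0) - F (x - i - p, 0, 0)))"
    by (simp add: sum_subtractf algebra_simps)
  also have "\<dots> = (\<Sum>i\<in>{0}. q i * (F (x - i, 0, 0) - F (x - i - p, 0, 0)))"
    using x(3) by (intro sum.mono_neutral_right) auto
  finally show False using q(1) x(2) by simp
qed

section \<open>The recursion for P-positions\<close>

lemma is_P_rec:
  assumes "wf (option_rel \<Gamma>)"
  shows "is_P \<Gamma> p \<longleftrightarrow> \<not> (\<exists>q. is_option \<Gamma> p q \<and> is_P \<Gamma> q)"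
proof -
  have "is_P \<Gamma> p \<longleftrightarrow> \<not> (\<exists>q. is_option \<Gamma> p q \<and> cut (is_P \<Gamma>) (option_rel \<Gamma>) p q)"
    using wfrec[OF assms, of "\<lambda>f p. \<not> (\<exists>q. is_option \<Gamma> p q \<and> f q)" p] unfolding is_P_def by simp
  moreover have "cut (is_P \<Gamma>) (option_rel \<Gamma>) p q = is_P \<Gamma> q" if "is_option \<Gamma> p q" for q
    using that by (simp add: cut_def option_rel_def)
  ultimately show ?thesis by blast
qed

section \<open>The pattern of P-positions\<close>

text \<open>A pair of rows \<open>y = 2 m\<close> and \<open>y = 2 m + 1\<close> is given by \<open>m\<close> and a flag \<open>od\<close> for the odd row.
  The value \<open>tri r\<close> is 8 times the \<open>(r - 1)\<close>-th triangular number: left of the parabola the block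
  \<open>r\<close> starts at \<open>x = tri r + 5\<close> and consists of \<open>r\<close> cells of width 8; the offset 5 makes the pattern within
  a cell depend on \<open>m\<close> and \<open>r\<close> only.\<close>

definition tri :: "int \<Rightarrow> int" where
  "tri r = 4 * r * (r - 1)"

definition upper :: "int \<Rightarrow> int \<Rightarrow> bool \<Rightarrow> int \<Rightarrow> bool" where
  "upper m r od t \<longleftrightarrow>
     (if od then t = 0 \<or> (t = 1 \<or> t = 2) \<and> even (m + r)
      else t = 5 \<or> (t = 3 \<or> t = 4) \<and> even (m + r) \<or> t = 1 \<and> r = m - 1)"

text \<open>Right of the parabola block \<open>j\<close> occupies the \<open>8 j + 6\<close> columns from \<open>tri j + 6 * (j - m)\<close> on; columns are
  written as \<open>8 * a + b\<close> with \<open>0 \<le> b < 8\<close> relative to this, which turns the pattern into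
  a comparison of \<open>a\<close>, \<open>m\<close> and \<open>j\<close>.\<close>

definition lower :: "int \<Rightarrow> int \<Rightarrow> bool \<Rightarrow> int \<Rightarrow> int \<Rightarrow> bool" where
  "lower m j od a b \<longleftrightarrow>
     (if od then b = 7 \<and> a < m \<or> b = 5 \<and> (a = m \<or> a = j)
      else (b = 0 \<or> b = 2) \<and> a \<le> j \<or> b = 1 \<and> a = 0
         \<or> b = 4 \<and> 0 < a \<and> a < j \<and> a \<noteq> m \<or> b = 6 \<and> m \<le> a \<and> a < j)"

text \<open>\<open>on_row\<close> is false outside the board, so that moves leaving it need no special treatment.\<close>

definition on_row :: "int \<Rightarrow> bool \<Rightarrow> int \<Rightarrow> bool" where
  "on_row m od x \<longleftrightarrow> 0 \<le> m \<and>
     (\<not> od \<and> 0 \<le> x \<and> x < 3 \<or>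
      (\<exists>r k t. 0 \<le> k \<and> k < r \<and> r < m \<and> 0 \<le> t \<and> t < 8 \<and> x = tri r + 8 * k + 5 + t \<and> upper m r od t) \<or>
      (\<exists>j a b. m \<le> j \<and> 0 \<le> a \<and> 0 \<le> b \<and> b < 8 \<and> 8 * a + b < 8 * j + 6 \<and> (j = m \<longrightarrow> 5 \<le> 8 * a + b)
         \<and> x = tri j + 6 * (j - m) + 8 * a + b \<and> lower m j od a b))"

section \<open>Block boundaries\<close>

lemma tri_succ: "tri (r + 1) = tri r + 8 * r"
  by (simp add: tri_def algebra_simps)

lemma tri_pred: "tri (r - 1) = tri r - 8 * r + 8"
  by (simp add: tri_def algebra_simps)

lemma tri_mono: "0 \<le> r \<Longrightarrow> r \<le> s \<Longrightarrow> tri r \<le> tri s"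
proof -
  assume "0 \<le> r" "r \<le> s"
  have "tri s - tri r = 4 * ((s - r) * (s + r - 1))"
    by (simp add: tri_def algebra_simps)
  moreover have "0 \<le> (s - r) * (s + r - 1)"
    using \<open>0 \<le> r\<close> \<open>r \<le> s\<close> by (cases "r = s") auto
  ultimately show ?thesis by linarith
qed

lemma tri_nonneg: "0 \<le> r \<Longrightarrow> 0 \<le> tri r"
  using tri_mono[of 0 r] by (simp add: tri_def)

lemma cell_unique:
  fixes a b :: int
  assumes "8 * a + b = 8 * a' + b'" "0 \<le> b" "b < 8" "0 \<le> b'" "b' < 8"
  shows "a = a'" "b = b'"
  using assms by presburger+

lemma upper_block_unique:
  assumes "tri r + u = tri r' + u'" "0 \<le> r" "0 \<le> r'" "0 \<le> u" "u < 8 * r" "0 \<le> u'" "u' < 8 * r'"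
  shows "r = r'"
  using tri_mono[of "r + 1" r'] tri_mono[of "r' + 1" r] assms tri_succ[of r] tri_succ[of r']
  by linarith

text \<open>Block \<open>j\<close> ends where block \<open>j + 1\<close> starts: \<open>tri\<close>
  grows by \<open>8 * j\<close> and the offset by 6.\<close>

lemma lower_block_unique:
  assumes "tri j + 6 * (j - m) + u = tri j' + 6 * (j' - m) + u'" "0 \<le> j" "0 \<le> j'"
    "0 \<le> u" "u < 8 * j + 6" "0 \<le> u'" "u' < 8 * j' + 6"
  shows "j = j'"
proof (rule linorder_cases[of j j'])
  assume "j < j'"
  then show ?thesis using tri_mono[of "j + 1" j'] assms tri_succ[of j] by auto
next
  assume "j' < j"
  then show ?thesis using tri_mono[of "j' + 1" j] assms tri_succ[of j'] by auto
qed

section \<open>The pattern region by region\<close>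

lemma on_row_neg_row: "m < 0 \<Longrightarrow> \<not> on_row m od x"
  by (simp add: on_row_def)

text \<open>With the first five columns of block \<open>m\<close> cut off, the right part starts at
  \<open>tri m + 5\<close>, exactly where the left part ends.\<close>

lemma lower_block_bound:
  assumes "0 \<le> m" "m \<le> j" "0 \<le> u" "j = m \<longrightarrow> 5 \<le> u" 
  shows "tri m + 5 \<le> tri j + 6 * (j - m) + (u::int)"
  using tri_mono[of m j] assms by (cases "j = m") auto

lemma upper_block_bound:
  assumes "0 \<le> r" "r < m" "u < 8 * r + 5"
  shows "tri r + u < tri m + 5"
  using tri_mono[of "r + 1" m] tri_succ[of r] assms by linarith

lemma on_row_margin:
  assumes "0 \<le> m" "x < 5"
  shows "on_row m od x \<longleftrightarrow> \<not> od \<and> 0 \<le> x \<and> x < 3"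
proof -
  have "x \<noteq> tri j + 6 * (j - m) + 8 * a + b"
    if "m \<le> j" "0 \<le> a" "0 \<le> b" "j = m \<longrightarrow> 5 \<le> 8 * a + b" for j a b
    using lower_block_bound[of m j "8 * a + b"] tri_nonneg[of m] assms that by auto
  moreover have "x \<noteq> tri r + 8 * k + 5 + t" if "0 \<le> k" "k < r" "0 \<le> t" for r k t
    using tri_nonneg[of r] assms that by auto
  ultimately show ?thesis unfolding on_row_def using assms by blast
qed

lemma on_row_upper:
  assumes "0 \<le> k" "k < r" "r < m" "0 \<le> t" "t < 8" "x = tri r + 8 * k + 5 + t"
  shows "on_row m od x \<longleftrightarrow> upper m r od t"
  unfolding assms(6)
proof
  assume "upper m r od t"
  moreover have "0 \<le> m" using assms by simp
  ultimately show "on_row m od (tri r + 8 * k + 5 + t)" unfolding on_row_def using assms by blast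
next
  let ?x = "tri r + 8 * k + 5 + t"
  assume on: "on_row m od ?x"
  have x: "?x < tri m + 5" "5 \<le> ?x"
    using upper_block_bound[of r m "8 * k + 5 + t"] assms tri_nonneg[of r] by auto
  have "?x \<noteq> tri j + 6 * (j - m) + 8 * a + b"
    if "m \<le> j" "0 \<le> a" "0 \<le> b" "j = m \<longrightarrow> 5 \<le> 8 * a + b" for j a b
    using lower_block_bound[of m j "8 * a + b"] x assms that by auto
  moreover have "\<not> ?x < 3" using x by linarith
  ultimately obtain r' k' t' where *: "0 \<le> k'" "k' < r'" "r' < m" "0 \<le> t'" "t' < 8"
     "?x = tri r' + 8 * k' + 5 + t'" "upper m r' od t'"
    using on unfolding on_row_def by blast
  then have "r = r'" using upper_block_unique[of r "8 * k + t" r' "8 * k' + t'"] assms by auto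
  then show "upper m r od t" using * cell_unique[of k t k' t'] assms by auto
qed

lemma on_row_lower:
  assumes "0 \<le> m" "m \<le> j" "0 \<le> a" "0 \<le> b" "b < 8" "8 * a + b < 8 * j + 6" "j = m \<longrightarrow> 5 \<le> 8 * a + b"
    "x = tri j + 6 * (j - m) + 8 * a + b"
  shows "on_row m od x \<longleftrightarrow> lower m j od a b"
  unfolding assms(8)
proof
  assume "lower m j od a b"
  then show "on_row m od (tri j + 6 * (j - m) + 8 * a + b)" unfolding on_row_def using assms by blast
next
  let ?x = "tri j + 6 * (j - m) + 8 * a + b"
  assume on: "on_row m od ?x"
  have x: "tri m + 5 \<le> ?x"
    using lower_block_bound[of m j "8 * a + b"] assms by auto
  then have "\<not> ?x < 3" using tri_nonneg[of m] assms by linarith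
  moreover have "?x \<noteq> tri r + 8 * k + 5 + t" if "0 \<le> k" "k < r" "r < m" "0 \<le> t" "t < 8" for r k t
    using upper_block_bound[of r m "8 * k + 5 + t"] x that by auto
  ultimately obtain j' a' b' where *: "m \<le> j'" "0 \<le> a'" "0 \<le> b'" "b' < 8" "8 * a' + b' < 8 * j' + 6"
     "?x = tri j' + 6 * (j' - m) + 8 * a' + b'" "lower m j' od a' b'"
    using on unfolding on_row_def by blast
  then have "j = j'" using lower_block_unique[of j m "8 * a + b" j' "8 * a' + b'"] assms by auto
  then show "lower m j od a b" using * cell_unique[of a b a' b'] assms by auto
qed

text \<open>The last block left of the parabola has the wrong parity for the triples of points and looks
  the same for all \<open>m\<close>.\<close>

lemma on_row_front:
  assumes "0 \<le> m" "2 \<le> 8 * a + b" "8 * a + b < 8 * m + 5" "0 \<le> b" "b < 8" "x = tri m + 8 * a + b"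
  shows "on_row (m + 1) od x \<longleftrightarrow> (if od then b = 5 else b = 2 \<or> b = 6)"
proof -
  have tri_small: "tri m = 0" if "m = 0 \<or> m = 1" using that by (auto simp: tri_def)
  have a: "0 \<le> a" "8 * a + b < 5 \<longrightarrow> a = 0" using assms by auto
  \<comment> \<open>Columns before 5 lie in the margin if \<open>tri m = 0\<close>, else in the last
    cell of block \<open>m - 1\<close>; later groups of eight split at \<open>b = 5\<close>, where
    cells begin.\<close>
  consider "m = 0 \<or> m = 1" "8 * a + b < 5" | "2 \<le> m" "8 * a + b < 5"
    | "5 \<le> 8 * a + b" "b < 5" | "5 \<le> 8 * a + b" "5 \<le> b"
    using assms(1,3) by linarith
  then show ?thesis
  proof cases
    case 1
    then have "a = 0" using a by blast
    then have "2 \<le> b" "b < 5" "x = b" using 1 tri_small assms(2,6) by simp_all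
    then show ?thesis using on_row_margin[of "m + 1" x od] assms(1) by auto
  next
    case 2
    then have "a = 0" using a by blast
    then have b: "2 \<le> b" "b < 5" using 2 assms(2) by simp_all
    have "on_row (m + 1) od x \<longleftrightarrow> upper (m + 1) (m - 1) od (b + 3)"
      using tri_pred[of m] assms(6) 2(1) b \<open>a = 0\<close> by (intro on_row_upper[where k = "m - 2"]) simp_all
    then show ?thesis using b by (auto simp: upper_def)
  next
    case 3
    then have "1 \<le> a" by linarith
    then have "on_row (m + 1) od x \<longleftrightarrow> upper (m + 1) m od (b + 3)"
      using assms 3(2) by (intro on_row_upper[where k = "a - 1"]) simp_all
    then show ?thesis using 3(2) assms(4) by (auto simp: upper_def)
  next
    case 4
    then have "on_row (m + 1) od x \<longleftrightarrow> upper (m + 1) m od (b - 5)"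
      using a assms by (intro on_row_upper[where k = a]) simp_all
    then show ?thesis using 4(2) assms(5) by (auto simp: upper_def)
  qed
qed

text \<open>In columns 2 to 4, cut off from block \<open>m\<close>, the left pattern or the margin
  agrees with \<open>lower\<close>. This lets options cross the parabola.\<close>

lemma on_row_lower_relaxed:
  assumes "0 \<le> m" "m \<le> j" "0 \<le> a" "0 \<le> b" "b < 8" "8 * a + b < 8 * j + 6" "j = m \<longrightarrow> 2 \<le> 8 * a + b"
    "x = tri j + 6 * (j - m) + 8 * a + b"
  shows "on_row m od x \<longleftrightarrow> lower m j od a b"
proof -
  have tri_small: "tri m = 0" if "m = 0 \<or> m = 1" using that by (auto simp: tri_def)
  consider "j = m \<longrightarrow> 5 \<le> 8 * a + b" | "j = m" "8 * a + b < 5" "m = 0 \<or> m = 1"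
    | "j = m" "8 * a + b < 5" "2 \<le> m" using assms(1) by linarith
  then show ?thesis
  proof cases
    case 1
    then show ?thesis using on_row_lower[of m j a b x od] assms by auto
  next
    case 2
    then have "a = 0" "b = 2 \<or> b = 3 \<or> b = 4" using assms by presburger+
    moreover have "x = b" using 2 calculation tri_small assms by auto
    ultimately show ?thesis using on_row_margin[of m x od] 2 assms by (auto simp: lower_def)
  next
    case 3
    then have "a = 0" "b = 2 \<or> b = 3 \<or> b = 4" using assms by presburger+
    then show ?thesis
      using on_row_upper[of "m - 2" "m - 1" m "b + 3" x od] tri_pred[of m] 3 assms
      by (auto simp: upper_def lower_def)
  qed
qed

section \<open>Kernel condition right of the parabola\<close>

text \<open>\<open>lower_ext\<close> continues the pattern of block \<open>j\<close> into its two neighbours, and \<open>lower_shift\<close>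
  admits \<open>b\<close> outside \<open>{0..<8}\<close>, so that every option of a position can be written in the coordinates of
  that position.\<close>

definition lower_ext :: "int \<Rightarrow> int \<Rightarrow> bool \<Rightarrow> int \<Rightarrow> int \<Rightarrow> bool" where
  "lower_ext m j od a b =
     (if a < 0 then if 2 \<le> b then lower m (j - 1) od (a + j) (b - 2) else lower m (j - 1) od (a + j - 1) (b + 6)
      else if a < j \<or> a = j \<and> b < 6 then lower m j od a b
      else if 6 \<le> b then lower m (j + 1) od (a - j) (b - 6)
      else lower m (j + 1) od (a - j - 1) (b + 2))"

text \<open>Block \<open>j - 1\<close> has length \<open>8 * j - 2\<close> and block
  \<open>j\<close> length \<open>8 * j + 6\<close>, hence the shifts of \<open>b\<close> by 2 and 6.
  The bound 4 amounts to column 2 of block \<open>j - 1\<close>, the least that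
  \<open>on_row_lower_relaxed\<close> allows if \<open>j - 1 = m\<close>.\<close>

lemma on_row_lower_ext:
  assumes "0 \<le> m" "m \<le> j" "0 \<le> b" "b < 8" "8 * a + b < 8 * j + 9"
    "j = m \<longrightarrow> 2 \<le> 8 * a + b" "a < 0 \<longrightarrow> 4 \<le> 8 * a + b + 8 * j" "x = tri j + 6 * (j - m) + 8 * a + b"
  shows "on_row m od x \<longleftrightarrow> lower_ext m j od a b"
proof -
  have "a < 0 \<longrightarrow> m < j" using assms by auto
  have last: "a = j \<or> a = j + 1" if "8 * j + 6 \<le> 8 * a + b" using assms(3-5) that by presburger
  consider "a < 0" "2 \<le> b" | "a < 0" "b < 2" | "0 \<le> a" "8 * a + b < 8 * j + 6"
    | "0 \<le> a" "a = j" "6 \<le> b" | "a = j + 1" "b = 0"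
    using last assms(3-5) by linarith
  then show ?thesis
  proof cases
    case 1
    then have "on_row m od x \<longleftrightarrow> lower m (j - 1) od (a + j) (b - 2)"
      using tri_pred[of j] assms \<open>a < 0 \<longrightarrow> m < j\<close> by (intro on_row_lower_relaxed) auto
    then show ?thesis using 1 by (simp add: lower_ext_def)
  next
    case 2
    then have "on_row m od x \<longleftrightarrow> lower m (j - 1) od (a + j - 1) (b + 6)"
      using tri_pred[of j] assms \<open>a < 0 \<longrightarrow> m < j\<close> by (intro on_row_lower_relaxed) auto
    then show ?thesis using 2 by (simp add: lower_ext_def)
  next
    case 3
    then have "on_row m od x \<longleftrightarrow> lower m j od a b"
      using assms by (intro on_row_lower_relaxed) auto
    moreover have "a < j \<or> a = j \<and> b < 6" using 3 assms(3) by presburger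
    ultimately show ?thesis using 3 by (simp add: lower_ext_def)
  next
    case 4
    then have "on_row m od x \<longleftrightarrow> lower m (j + 1) od 0 (b - 6)"
      using tri_succ[of j] assms by (intro on_row_lower_relaxed) auto
    then show ?thesis using 4 by (simp add: lower_ext_def)
  next
    case 5
    then have "on_row m od x \<longleftrightarrow> lower m (j + 1) od 0 2"
      using tri_succ[of j] assms by (intro on_row_lower_relaxed) auto
    moreover have "0 \<le> j" using assms by linarith
    ultimately show ?thesis using 5 by (simp add: lower_ext_def)
  qed
qed

definition lower_shift :: "int \<Rightarrow> int \<Rightarrow> bool \<Rightarrow> int \<Rightarrow> int \<Rightarrow> bool" where
  "lower_shift m j od a b =
     (if b < -8 then lower_ext m j od (a - 2) (b + 16) else if b < 0 then lower_ext m j od (a - 1) (b + 8)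
      else if b < 8 then lower_ext m j od a b else lower_ext m j od (a + 1) (b - 8))"

lemma on_row_lower_shift:
  assumes "0 \<le> m" "m \<le> j" "-16 \<le> b" "b < 16" "8 * a + b < 8 * j + 9"
    "j = m \<longrightarrow> 2 \<le> 8 * a + b" "4 \<le> 8 * a + b + 8 * j \<or> 0 \<le> 8 * a + b"
    "x = tri j + 6 * (j - m) + 8 * a + b"
  shows "on_row m od x \<longleftrightarrow> lower_shift m j od a b"
proof -
  consider "b < -8" | "-8 \<le> b" "b < 0" | "0 \<le> b" "b < 8" | "8 \<le> b" by linarith
  then show ?thesis
  proof cases
    case 1
    then show ?thesis using on_row_lower_ext[of m j "b + 16" "a - 2" x od] assms
      by (auto simp: lower_shift_def)
  next
    case 2
    then show ?thesis using on_row_lower_ext[of m j "b + 8" "a - 1" x od] assms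
      by (auto simp: lower_shift_def)
  next
    case 3
    then show ?thesis using on_row_lower_ext[of m j b a x od] assms
      by (auto simp: lower_shift_def)
  next
    case 4
    then show ?thesis using on_row_lower_ext[of m j "b - 8" "a + 1" x od] assms
      by (auto simp: lower_shift_def)
  qed
qed

text \<open>Blocks start 6 columns earlier in each higher pair, so an option in pair
  \<open>m + s\<close> has its column raised by \<open>6 * s\<close>: \<open>b - 4\<close> is
  \<open>b + 2 - 6\<close> and \<open>b + 3\<close> is \<open>b - 3 + 6\<close>. For
  \<open>j = m\<close> the pair above is left of its parabola and follows
  \<open>on_row_front\<close>. Eight values of \<open>b\<close> remain to be checked.\<close>

lemma lower_local_odd:
  assumes "0 \<le> m" "m \<le> j" "0 \<le> a" "0 \<le> b" "b < 8" "8 * a + b < 8 * j + 6" "j = m \<longrightarrow> 5 \<le> 8 * a + b"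
  shows "lower m j True a b \<longleftrightarrow> \<not> (1 \<le> m \<and> lower_shift (m - 1) j False a (b - 4) \<or> lower_shift m j False a b
    \<or> lower_shift m j False a (b - 1) \<or> lower_shift m j False a (b - 2)
    \<or> (if m < j then lower_shift (m + 1) j True a (b + 3) else b = 0)
    \<or> lower_shift m j True a (b - 3))"
proof -
  consider "b = 0" | "b = 1" | "b = 2" | "b = 3" | "b = 4" | "b = 5" | "b = 6" | "b = 7"
    using assms by linarith
  then show ?thesis
  by cases (insert assms, auto simp: lower_def lower_ext_def lower_shift_def)
qed

lemma lower_local_even:
  assumes "0 \<le> m" "m \<le> j" "0 \<le> a" "0 \<le> b" "b < 8" "8 * a + b < 8 * j + 6" "j = m \<longrightarrow> 5 \<le> 8 * a + b"
  shows "lower m j False a b \<longleftrightarrow> \<not> (2 \<le> m \<and> lower_shift (m - 2) j True a (b - 10)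
    \<or> 1 \<le> m \<and> (lower_shift (m - 1) j True a (b - 6)
    \<or> lower_shift (m - 1) j True a (b - 7) \<or> lower_shift (m - 1) j True a (b - 8))
    \<or> (if m < j then lower_shift (m + 1) j False a (b + 3) else b = 5 \<or> b = 1)
    \<or> lower_shift m j False a (b - 3))"
proof -
  consider "b = 0" | "b = 1" | "b = 2" | "b = 3" | "b = 4" | "b = 5" | "b = 6" | "b = 7"
    using assms by linarith
  then show ?thesis
  by cases (insert assms, auto simp: lower_def lower_ext_def lower_shift_def)
qed

text \<open>The six moves within the plane in pair coordinates; the row three below has the other
  parity and lies one pair lower for odd rows, two for even ones.\<close>

definition P_neighbour :: "int \<Rightarrow> bool \<Rightarrow> int \<Rightarrow> bool" where
  "P_neighbour m od x \<longleftrightarrow>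
     on_row (if od then m - 1 else m - 2) (\<not> od) (x + 2) \<or>
     (\<exists>d\<in>{0, 1, 2}. on_row (if od then m else m - 1) (\<not> od) (x - d)) \<or>
     on_row (m + 1) od (x - 3) \<or> on_row m od (x - 3)"

lemma on_row_kernel_lower:
  assumes "0 \<le> m" "m \<le> j" "0 \<le> a" "0 \<le> b" "b < 8" "8 * a + b < 8 * j + 6" "j = m \<longrightarrow> 5 \<le> 8 * a + b"
    "x = tri j + 6 * (j - m) + 8 * a + b"
  shows "on_row m od x \<longleftrightarrow> \<not> P_neighbour m od x"
proof -
  have x: "on_row m od x \<longleftrightarrow> lower m j od a b" using on_row_lower assms by blast
  have left: "on_row m od (x - 3) \<longleftrightarrow> lower_shift m j od a (b - 3)"
    using assms by (intro on_row_lower_shift) auto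
  have up: "on_row (m + 1) od (x - 3) \<longleftrightarrow> lower_shift (m + 1) j od a (b + 3)" if "m < j"
    using assms that by (intro on_row_lower_shift) auto
  \<comment> \<open>Here \<open>x - 3\<close> lies left of the parabola of pair
    \<open>m + 1\<close>, in the range of \<open>on_row_front\<close>; for \<open>b < 3\<close> a
    unit is borrowed from \<open>a\<close>.\<close>
  have up_front: "on_row (m + 1) od (x - 3) \<longleftrightarrow> (if od then b = 0 else b = 1 \<or> b = 5)" if "\<not> m < j"
  proof (cases "b < 3")
    case True
    then show ?thesis using on_row_front[of m "a - 1" "b + 5" "x - 3" od] that assms by auto
  next
    case False
    then show ?thesis using on_row_front[of m a "b - 3" "x - 3" od] that assms by auto
  qed
  show ?thesis
  proof (cases od)
    case True
    have "on_row (m - 1) False (x + 2) \<longleftrightarrow> 1 \<le> m \<and> lower_shift (m - 1) j False a (b - 4)"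
    proof (cases "1 \<le> m")
      case True
      then have "on_row (m - 1) False (x + 2) \<longleftrightarrow> lower_shift (m - 1) j False a (b - 4)"
        using assms by (intro on_row_lower_shift) auto
      then show ?thesis using True by simp
    qed (simp add: on_row_neg_row)
    moreover have "on_row m False (x - d) \<longleftrightarrow> lower_shift m j False a (b - d)" if "d \<in> {0, 1, 2}" for d
      using assms that by (intro on_row_lower_shift) auto
    ultimately show ?thesis
      using True x left up up_front lower_local_odd[of m j a b] assms by (auto simp: P_neighbour_def)
  next
    case False
    have "on_row (m - 2) True (x + 2) \<longleftrightarrow> 2 \<le> m \<and> lower_shift (m - 2) j True a (b - 10)"
    proof (cases "2 \<le> m")
      case True
      then have "on_row (m - 2) True (x + 2) \<longleftrightarrow> lower_shift (m - 2) j True a (b - 10)"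
        using assms by (intro on_row_lower_shift) auto
      then show ?thesis using True by simp
    qed (simp add: on_row_neg_row)
    moreover have "on_row (m - 1) True (x - d) \<longleftrightarrow> 1 \<le> m \<and> lower_shift (m - 1) j True a (b - 6 - d)"
      if "d \<in> {0, 1, 2}" for d
    proof (cases "1 \<le> m")
      case True
      then have "on_row (m - 1) True (x - d) \<longleftrightarrow> lower_shift (m - 1) j True a (b - 6 - d)"
        using assms that by (intro on_row_lower_shift) auto
      then show ?thesis using True by simp
    qed (simp add: on_row_neg_row)
    ultimately show ?thesis
      using False x left up up_front lower_local_even[of m j a b] assms by (auto simp: P_neighbour_def)
  qed
qed

section \<open>Kernel condition left of the parabola\<close>

text \<open>Columns -3 to 9 reach the adjacent cells. The three columns before a cell look alike in
  every block and in the margin, so \<open>t < 0\<close> needs no further cases; past the last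
  block, columns 8 and 9 are empty.\<close>

definition upper_ext :: "int \<Rightarrow> int \<Rightarrow> bool \<Rightarrow> int \<Rightarrow> int \<Rightarrow> bool" where
  "upper_ext m r od k t =
     (if t < 0 then \<not> od \<and> t = -3
      else if t < 8 then upper m r od t
      else if k + 1 < r then upper m r od (t - 8)
      else r + 1 < m \<and> upper m (r + 1) od (t - 8))"

lemma on_row_upper_ext:
  assumes "0 \<le> k" "k < r" "r < m" "-3 \<le> t" "t < 10" "x = tri r + 8 * k + 5 + t"
  shows "on_row m od x \<longleftrightarrow> upper_ext m r od k t"
proof -
  have "r = 1 \<or> 2 \<le> r" using assms by linarith
  then consider "t < 0" "1 \<le> k" | "t < 0" "k = 0" "r = 1" | "t < 0" "k = 0" "2 \<le> r" | "0 \<le> t" "t < 8"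
    | "8 \<le> t" "k + 1 < r" | "8 \<le> t" "k + 1 = r" "r + 1 < m" | "8 \<le> t" "k + 1 = r" "r + 1 = m"
    using assms by linarith
  then show ?thesis
  proof cases
    case 1
    then have "on_row m od x \<longleftrightarrow> upper m r od (t + 8)" using assms by (intro on_row_upper[where k = "k - 1"]) auto
    then show ?thesis using 1 assms by (auto simp: upper_ext_def upper_def)
  next
    case 2
    then have "x = 5 + t" "0 \<le> m" using assms by (simp_all add: tri_def)
    then show ?thesis using on_row_margin[of m x od] 2(1) assms(4) by (auto simp: upper_ext_def)
  next
    case 3
    then have "on_row m od x \<longleftrightarrow> upper m (r - 1) od (t + 8)"
      using assms tri_pred[of r] by (intro on_row_upper[where k = "r - 2"]) auto
    then show ?thesis using 3 assms by (auto simp: upper_ext_def upper_def)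
  next
    case 4
    then have "on_row m od x \<longleftrightarrow> upper m r od t" using assms by (intro on_row_upper[where k = k]) auto
    then show ?thesis using 4 by (simp add: upper_ext_def)
  next
    case 5
    then have "on_row m od x \<longleftrightarrow> upper m r od (t - 8)" using assms by (intro on_row_upper[where k = "k + 1"]) auto
    then show ?thesis using 5 by (simp add: upper_ext_def)
  next
    case 6
    then have "on_row m od x \<longleftrightarrow> upper m (r + 1) od (t - 8)"
      using assms tri_succ[of r] by (intro on_row_upper[where k = 0]) auto
    then show ?thesis using 6 by (simp add: upper_ext_def)
  next
    case 7
    then have "on_row m od x \<longleftrightarrow> lower m m od 0 (t - 3)"
      using assms tri_succ[of r] by (intro on_row_lower) auto
    then show ?thesis using 7 assms by (auto simp: upper_ext_def lower_def)
  qed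
qed

text \<open>For \<open>r = m - 1\<close> the pair below has block \<open>r\<close> right of its
  parabola, with \<open>x\<close> at column \<open>8 * k + 5 + t\<close>; the move to
  \<open>x + 2\<close> thus gives \<open>t + 7\<close>. The rest is a check of eight values of
  \<open>t\<close>.\<close>

lemma upper_local_odd:
  assumes "0 \<le> k" "k < r" "r < m" "0 \<le> t" "t < 8"
  shows "upper m r True t \<longleftrightarrow>
    \<not> ((if r < m - 1 then upper_ext (m - 1) r False k (t + 2) else lower_shift r r False k (t + 7))
     \<or> upper_ext m r False k t \<or> upper_ext m r False k (t - 1) \<or> upper_ext m r False k (t - 2)
     \<or> upper_ext (m + 1) r True k (t - 3) \<or> upper_ext m r True k (t - 3))"
proof -
  have "t = 0 \<or> t = 1 \<or> t = 2 \<or> t = 3 \<or> t = 4 \<or> t = 5 \<or> t = 6 \<or> t = 7"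
    using assms by linarith
  moreover have "r < m - 1 \<or> m = r + 1" using assms by linarith
  ultimately show ?thesis
    by (elim disjE) (insert assms, auto simp: upper_def upper_ext_def lower_def lower_ext_def lower_shift_def)
qed

text \<open>Two pairs lower, block \<open>r = m - 1\<close> is the second one right of the parabola
  and starts 6 later, which turns \<open>t + 7\<close> into \<open>t + 1\<close>.\<close>

lemma upper_local_even:
  assumes "0 \<le> k" "k < r" "r < m" "0 \<le> t" "t < 8"
  defines "nbr \<equiv> \<lambda>t. if r < m - 1 then upper_ext (m - 1) r True k t else lower_shift r r True k (t + 5)"
  shows "upper m r False t \<longleftrightarrow>
    \<not> ((if r < m - 2 then upper_ext (m - 2) r True k (t + 2)
        else if r = m - 2 then lower_shift r r True k (t + 7) else lower_shift (m - 2) r True k (t + 1))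
     \<or> nbr t \<or> nbr (t - 1) \<or> nbr (t - 2)
     \<or> upper_ext (m + 1) r False k (t - 3) \<or> upper_ext m r False k (t - 3))"
proof -
  have "t = 0 \<or> t = 1 \<or> t = 2 \<or> t = 3 \<or> t = 4 \<or> t = 5 \<or> t = 6 \<or> t = 7"
    using assms by linarith
  moreover have "r < m - 2 \<or> m = r + 1 \<or> m = r + 2" using assms by linarith
  ultimately show ?thesis
    by (elim disjE)
      (insert assms(1-5), auto simp: nbr_def upper_def upper_ext_def lower_def lower_ext_def lower_shift_def)
qed

lemma on_row_kernel_upper:
  assumes "0 \<le> k" "k < r" "r < m" "0 \<le> t" "t < 8" "x = tri r + 8 * k + 5 + t"
  shows "on_row m od x \<longleftrightarrow> \<not> P_neighbour m od x"
proof -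
  have x: "on_row m od x \<longleftrightarrow> upper m r od t" using on_row_upper assms by blast
  have left: "on_row m od (x - 3) \<longleftrightarrow> upper_ext m r od k (t - 3)"
    using assms by (intro on_row_upper_ext) auto
  have up: "on_row (m + 1) od (x - 3) \<longleftrightarrow> upper_ext (m + 1) r od k (t - 3)"
    using assms by (intro on_row_upper_ext) auto
  show ?thesis
  proof (cases od)
    case True
    have "on_row (m - 1) False (x + 2) \<longleftrightarrow>
      (if r < m - 1 then upper_ext (m - 1) r False k (t + 2) else lower_shift r r False k (t + 7))"
    proof (cases "r < m - 1")
      case True
      then have "on_row (m - 1) False (x + 2) \<longleftrightarrow> upper_ext (m - 1) r False k (t + 2)"
        using assms by (intro on_row_upper_ext) auto
      then show ?thesis using True by simp
    next
      case False
      then have "m - 1 = r" using assms by linarith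
      moreover have "on_row r False (x + 2) \<longleftrightarrow> lower_shift r r False k (t + 7)"
        using assms by (intro on_row_lower_shift) auto
      ultimately show ?thesis by simp
    qed
    moreover have "on_row m False (x - d) \<longleftrightarrow> upper_ext m r False k (t - d)" if "d \<in> {0, 1, 2}" for d
      using assms that by (intro on_row_upper_ext) auto
    ultimately show ?thesis
      using True x left up upper_local_odd[of k r m t] assms by (auto simp: P_neighbour_def)
  next
    case False
    have "on_row (m - 2) True (x + 2) \<longleftrightarrow>
      (if r < m - 2 then upper_ext (m - 2) r True k (t + 2)
        else if r = m - 2 then lower_shift r r True k (t + 7) else lower_shift (m - 2) r True k (t + 1))"
    proof -
      consider "r < m - 2" | "r = m - 2" | "r = m - 1" using assms by linarith
      then show ?thesis
      proof cases
        case 1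
        then have "on_row (m - 2) True (x + 2) \<longleftrightarrow> upper_ext (m - 2) r True k (t + 2)"
          using assms by (intro on_row_upper_ext) auto
        then show ?thesis using 1 by simp
      next
        case 2
        have "on_row r True (x + 2) \<longleftrightarrow> lower_shift r r True k (t + 7)"
          using assms by (intro on_row_lower_shift) auto
        then show ?thesis using 2 by simp
      next
        case 3
        then have "on_row (m - 2) True (x + 2) \<longleftrightarrow> lower_shift (m - 2) r True k (t + 1)"
          using assms by (intro on_row_lower_shift) auto
        then show ?thesis using 3 by simp
      qed
    qed
    moreover have "on_row (m - 1) True (x - d) \<longleftrightarrow>
       (if r < m - 1 then upper_ext (m - 1) r True k (t - d) else lower_shift r r True k (t - d + 5))"
      if "d \<in> {0, 1, 2}" for d
    proof (cases "r < m - 1")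
      case True
      then have "on_row (m - 1) True (x - d) \<longleftrightarrow> upper_ext (m - 1) r True k (t - d)"
        using assms that by (intro on_row_upper_ext) auto
      then show ?thesis using True by simp
    next
      case False
      then have "m - 1 = r" using assms by linarith
      moreover have "on_row r True (x - d) \<longleftrightarrow> lower_shift r r True k (t - d + 5)"
        using assms that by (intro on_row_lower_shift) auto
      ultimately show ?thesis by simp
    qed
    ultimately show ?thesis
      using False x left up upper_local_even[of k r m t] assms by (simp add: P_neighbour_def)
  qed
qed

section \<open>Margin, covering of a row and the full kernel condition\<close>

text \<open>Odd rows reach columns 0 to 2 of the even row below, columns 3 and 4 of an even row
  reach columns 0 and 1, and columns 0 to 2 of even rows have options only in odd rows, where the
  margin is empty.\<close>

lemma on_row_kernel_margin:
  assumes "0 \<le> m" "0 \<le> x" "x < 5"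
  shows "on_row m od x \<longleftrightarrow> \<not> P_neighbour m od x"
proof -
  have "on_row m' od' x' \<longleftrightarrow> 0 \<le> m' \<and> \<not> od' \<and> 0 \<le> x' \<and> x' < 3" if "x' < 5" for m' od' x'
    using on_row_margin[of m' x' od'] on_row_neg_row[of m' od' x'] that by (cases "0 \<le> m'") simp_all
  then show ?thesis using assms unfolding P_neighbour_def by auto
qed

text \<open>Raising \<open>m\<close> by one adds exactly block \<open>m\<close>.\<close>

lemma upper_cover:
  assumes "0 \<le> m" "5 \<le> x" "x < tri m + 5"
  shows "\<exists>r k t. 0 \<le> k \<and> k < r \<and> r < m \<and> 0 \<le> t \<and> t < 8 \<and> x = tri r + 8 * k + 5 + t"
  using assms
proof (induction m rule: int_ge_induct)
  case base
  then show ?case by (simp add: tri_def)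
next
  case (step m)
  show ?case
  proof (cases "x < tri m + 5")
    case True
    then obtain r k t where "0 \<le> k" "k < r" "r < m" "0 \<le> t" "t < 8" "x = tri r + 8 * k + 5 + t"
      using step by blast
    moreover have "r < m + 1" using \<open>r < m\<close> by simp
    ultimately show ?thesis by blast
  next
    case False
    define u where "u = x - tri m - 5"
    have "0 \<le> u" "u < 8 * m" using False step tri_succ[of m] by (auto simp: u_def)
    then have "0 \<le> u div 8" "u div 8 < m" "0 \<le> u mod 8" "u mod 8 < 8" by auto
    moreover have "x = tri m + 8 * (u div 8) + 5 + u mod 8" by (simp add: u_def)
    moreover have "m < m + 1" by simp
    ultimately show ?thesis by blast
  qed
qed

lemma lower_cover:
  assumes "0 \<le> m" "tri m \<le> x"
  shows "\<exists>j a b. m \<le> j \<and> 0 \<le> a \<and> 0 \<le> b \<and> b < 8 \<and> 8 * a + b < 8 * j + 6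
     \<and> x = tri j + 6 * (j - m) + 8 * a + b"
proof -
  have "x < tri n + 6 * (n - m) \<Longrightarrow> ?thesis" if "m \<le> n" for n
    using that
  proof (induction n rule: int_ge_induct)
    case base
    then show ?case using assms by simp
  next
    case (step n)
    show ?case
    proof (cases "x < tri n + 6 * (n - m)")
      case False
      define u where "u = x - tri n - 6 * (n - m)"
      have "0 \<le> u" "u < 8 * n + 6" using False step tri_succ[of n] by (auto simp: u_def)
      then have "0 \<le> u div 8" "0 \<le> u mod 8" "u mod 8 < 8" "8 * (u div 8) + u mod 8 < 8 * n + 6" by auto
      moreover have "x = tri n + 6 * (n - m) + 8 * (u div 8) + u mod 8" by (simp add: u_def)
      ultimately show ?thesis using \<open>m \<le> n\<close> by blast
    qed (use step in blast)
  qed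
  moreover have x: "0 \<le> x" using assms tri_nonneg[of m] by linarith
  \<comment> \<open>The choice \<open>n = m + x + 1\<close> is large enough, as the offset
    \<open>6 * (n - m)\<close> alone exceeds \<open>x\<close>.\<close>
  moreover have "0 \<le> tri (m + x + 1)" using x assms by (intro tri_nonneg) simp
  then have "x < tri (m + x + 1) + 6 * (m + x + 1 - m)" using x by simp
  moreover have "m \<le> m + x + 1" using x by simp
  ultimately show ?thesis by blast
qed

lemma on_row_kernel:
  assumes "0 \<le> m" "0 \<le> x"
  shows "on_row m od x \<longleftrightarrow> \<not> P_neighbour m od x"
proof -
  consider "x < 5" | "5 \<le> x" "x < tri m + 5" | "tri m + 5 \<le> x" by linarith
  then show ?thesis
  proof cases
    case 1
    then show ?thesis using on_row_kernel_margin assms by blast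
  next
    case 2
    then show ?thesis using upper_cover[of m x] on_row_kernel_upper assms by blast
  next
    case 3
    then obtain j a b where "m \<le> j" "0 \<le> a" "0 \<le> b" "b < 8" "8 * a + b < 8 * j + 6"
       "x = tri j + 6 * (j - m) + 8 * a + b"
      using lower_cover[of m x] assms by auto
    moreover from this have "j = m \<longrightarrow> 5 \<le> 8 * a + b" using 3 by auto
    ultimately show ?thesis using on_row_kernel_lower assms by blast
  qed
qed

lemma on_row_nonneg:
  assumes "on_row m od x"
  shows "0 \<le> m" "0 \<le> x"
proof -
  show m: "0 \<le> m" using assms by (simp add: on_row_def)
  show "0 \<le> x"
  proof (rule ccontr)
    assume "\<not> 0 \<le> x"
    then show False using on_row_margin[of m x od] m assms by simp
  qed
qed

definition on_plane :: "int \<Rightarrow> int \<Rightarrow> bool" where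
  "on_plane x y \<longleftrightarrow> on_row (y div 2) (odd y) x"

lemma on_plane_nonneg: "on_plane x y \<Longrightarrow> 0 \<le> x \<and> 0 \<le> y"
  using on_row_nonneg[of "y div 2" "odd y" x] by (auto simp: on_plane_def)

lemma on_plane_kernel:
  assumes "0 \<le> x" "0 \<le> y"
  shows "on_plane x y \<longleftrightarrow> \<not> (\<exists>(x', y') \<in> {(x + 2, y - 3), (x, y - 1), (x - 1, y - 1),
       (x - 2, y - 1), (x - 3, y + 2), (x - 3, y)}. on_plane x' y')"
proof -
  have "P_neighbour (y div 2) (odd y) x \<longleftrightarrow> (\<exists>(x', y') \<in> {(x + 2, y - 3), (x, y - 1), (x - 1, y - 1),
       (x - 2, y - 1), (x - 3, y + 2), (x - 3, y)}. on_plane x' y')"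
  proof (cases "even y")
    case True
    then have "(y - 3) div 2 = y div 2 - 2" "(y - 1) div 2 = y div 2 - 1" by presburger+
    then show ?thesis using True by (auto simp: P_neighbour_def on_plane_def)
  next
    case False
    then have "(y - 3) div 2 = y div 2 - 1" "(y - 1) div 2 = y div 2" by presburger+
    then show ?thesis using False by (auto simp: P_neighbour_def on_plane_def)
  qed
  then show ?thesis using on_row_kernel[of "y div 2" x "odd y"] assms by (simp add: on_plane_def)
qed

section \<open>The game\<close>

text \<open>The rule \<open>(0, 0, 1)\<close> supplies the third axis of the tangent cone axiom. All
  coordinate sums are positive, which gives pointedness and termination.\<close>

definition parabola_rules :: "rule set" where
  "parabola_rules = {(-2, 3, 0), (0, 1, 0), (1, 1, 0), (2, 1, 0), (3, -2, 0), (3, 0, 0), (0, 0, 1)}"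

lemma ruleset_parabola_rules: "ruleset parabola_rules"
  unfolding ruleset_def
proof (intro conjI)
  show "pointed parabola_rules"
    unfolding pointed_def by (intro exI[of _ "1::real"]) (simp add: parabola_rules_def)
  show "tangent_cone_axiom parabola_rules"
    unfolding tangent_cone_axiom_def parabola_rules_def by simp
qed (simp add: parabola_rules_def)

lemma wf_parabola_rules: "wf (option_rel parabola_rules)"
proof (rule wf_subset[OF wf_measure])
  show "option_rel parabola_rules \<subseteq> measure (\<lambda>(x, y, z). x + y + z)"
    by (auto simp: option_rel_def is_option_def parabola_rules_def)
qed

lemma is_option_parabola_rules:
  "is_option parabola_rules (x, y, 0) (x', y', z') \<longleftrightarrow>
     z' = 0 \<and> (int x', int y') \<in> {(int x + 2, int y - 3), (int x, int y - 1), (int x - 1, int y - 1),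
       (int x - 2, int y - 1), (int x - 3, int y + 2), (int x - 3, int y)}"
  by (auto simp: is_option_def parabola_rules_def)

text \<open>Both sides obey the same recursion and planar moves lower \<open>x + y\<close>. Since
  \<open>on_plane\<close> fails off the board, options may range over integer points.\<close>

lemma is_P_parabola_rules: "is_P parabola_rules (x, y, 0) \<longleftrightarrow> on_plane (int x) (int y)"
proof (induction "x + y" arbitrary: x y rule: less_induct)
  case less
  define opts where "opts = {(int x + 2, int y - 3), (int x, int y - 1), (int x - 1, int y - 1),
       (int x - 2, int y - 1), (int x - 3, int y + 2), (int x - 3, int y)}"
  have smaller: "x' + y' < x + y" if "(int x', int y') \<in> opts" for x' y'
    using that by (auto simp: opts_def)
  have "is_P parabola_rules (x, y, 0) \<longleftrightarrow>
      \<not> (\<exists>x' y'. (int x', int y') \<in> opts \<and> is_P parabola_rules (x', y', 0))"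
    by (subst is_P_rec[OF wf_parabola_rules]) (auto simp: is_option_parabola_rules opts_def)
  also have "\<dots> \<longleftrightarrow> \<not> (\<exists>x' y'. (int x', int y') \<in> opts \<and> on_plane (int x') (int y'))"
    using less smaller by blast
  also have "\<dots> \<longleftrightarrow> \<not> (\<exists>(x', y') \<in> opts. on_plane x' y')"
  proof -
    have "\<exists>a b. (int a, int b) \<in> opts \<and> on_plane (int a) (int b)" if "(x', y') \<in> opts" "on_plane x' y'" for x' y'
      using on_plane_nonneg[OF that(2)] that by (intro exI[of _ "nat x'"] exI[of _ "nat y'"]) simp
    then show ?thesis by blast
  qed
  also have "\<dots> \<longleftrightarrow> on_plane (int x) (int y)"
    using on_plane_kernel[of "int x" "int y"] by (simp add: opts_def)
  finally show ?case .
qed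

text \<open>With \<open>m = 0\<close> the clause \<open>b = 6\<close> covers every
  \<open>a < j\<close>, so the even columns are complete but for the gap at \<open>a = j\<close>,
  \<open>b = 4\<close>; starting at 6 skips the irregular columns 1 and 4.\<close>

lemma on_row_bottom_row:
  assumes "0 \<le> j" "6 \<le> u" "u \<le> 8 * j + 5"
  shows "on_row 0 False (tri j + 6 * j + u) \<longleftrightarrow> even u \<and> u \<noteq> 8 * j + 4"
proof -
  define a b where "a = u div 8" and "b = u mod 8"
  have u: "u = 8 * a + b" "0 \<le> b" "b < 8" by (auto simp: a_def b_def)
  have "on_row 0 False (tri j + 6 * j + u) \<longleftrightarrow> lower 0 j False a b"
    using u assms by (intro on_row_lower) auto
  also have "\<dots> \<longleftrightarrow> even u \<and> u \<noteq> 8 * j + 4"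
  proof -
    have "b = 0 \<or> b = 1 \<or> b = 2 \<or> b = 3 \<or> b = 4 \<or> b = 5 \<or> b = 6 \<or> b = 7" using u by linarith
    moreover have "u = 8 * j + 4 \<longleftrightarrow> a = j \<and> b = 4" using u by presburger
    moreover have "even u \<longleftrightarrow> even b" using u by presburger
    ultimately show ?thesis using assms u(1) by (elim disjE) (auto simp: lower_def)
  qed
  finally show ?thesis .
qed

theorem theorem1p1:
  shows "\<exists>\<Gamma> :: rule set. ruleset \<Gamma> \<and> \<not> rational_ps (gen_fun (P_positions \<Gamma>))"
proof (intro exI conjI)
  show "ruleset parabola_rules" by (rule ruleset_parabola_rules)
  let ?F = "gen_fun (P_positions parabola_rules)"
  have F: "?F (x, 0, 0) = of_bool (on_row 0 False (int x))" for x
    using is_P_parabola_rules[of x 0] by (simp add: gen_fun_def P_positions_def on_plane_def)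
  show "\<not> rational_ps ?F"
  proof (rule not_rational_ps_axis[where p = 2])
    fix d :: nat
    \<comment> \<open>Large enough for the \<open>d + 2\<close> columns before the gap
      \<open>8 * j + 4\<close> to stay at column 6 or later of block \<open>j\<close>;
      \<open>x\<close> is that gap.\<close>
    define j where "j = int d + 2"
    define x where "x = nat (tri j + 6 * j + (8 * j + 4))"
    have x: "int x = tri j + 6 * j + (8 * j + 4)"
      using tri_nonneg[of j] by (simp add: x_def j_def)
    have row: "?F (x - i, 0, 0) = of_bool (even i \<and> i \<noteq> 0)" if "i \<le> d + 2" for i
    proof -
      have "int (x - i) = tri j + 6 * j + (8 * j + 4 - int i)"
        using x that tri_nonneg[of j] by (simp add: j_def)
      then show ?thesis
        using on_row_bottom_row[of j "8 * j + 4 - int i"] that by (simp add: F j_def)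
    qed
    have "?F (x, 0, 0) \<noteq> ?F (x - 2, 0, 0)" using row[of 0] row[of 2] by simp
    moreover have "?F (x - i, 0, 0) = ?F (x - i - 2, 0, 0)" if "i \<in> {1..d}" for i
      using row[of i] row[of "i + 2"] that by simp
    moreover have "d + 2 \<le> x" using x tri_nonneg[of j] by (simp add: j_def)
    ultimately show "\<exists>x. d + 2 \<le> x \<and> ?F (x, 0, 0) \<noteq> ?F (x - 2, 0, 0) \<and>
        (\<forall>i\<in>{1..d}. ?F (x - i, 0, 0) = ?F (x - i - 2, 0, 0))" by blast
  qed
qed

end
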